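(* Let $\Omega_1,\dots,\Omega_k$ be pairwise disjoint non-empty subsets of $[n]$, let $G_i\le\mathrm{Sym}(\Omega_i)$ for $1\le i\le k$, and let $G=G_1\cdot G_2\cdots G_k$ be their internal direct product (the group of permutations $g_1g_2\cdots g_k$, $g_i\in G_i$, with componentwise multiplication), acting on $\Omega=\Omega_1\cup\cdots\cup\Omega_k$ by $x^{g_1\cdots g_k}=g_i(x)$ for $x\in\Omega_i$. If every $G_i$, acting on $\Omega_i$, has the EKR property, then $G$, acting on $\Omega$, has the EKR property.
   Context: For a group $G$ acting faithfully on a finite set $\Omega$: $\pi,\sigma\in G$ intersect if $\pi\sigma^{-1}$ fixes some point of $\Omega$; a subset is intersecting if every pair of its elements intersect. $G$ has the EKR property if every intersecting subset of $G$ has size at most the size of the largest point-stabilizer $G_x$, $x\in\Omega$. *)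

theory Defs
  imports
    "HOL-Algebra.Group_Action"
    "HOL-Combinatorics.Permutations"
    "HOL-Library.Disjoint_Sets"
begin

definition intersecting ::
    "('g, 'm) monoid_scheme \<Rightarrow> 'a set \<Rightarrow> ('g \<Rightarrow> 'a \<Rightarrow> 'a) \<Rightarrow> 'g set \<Rightarrow> bool"
  where "intersecting G \<Omega> \<phi> F \<longleftrightarrow>
    F \<subseteq> carrier G \<and>
    (\<forall>\<pi>\<in>F. \<forall>\<sigma>\<in>F. \<exists>x\<in>\<Omega>. \<phi> (\<pi> \<otimes>\<^bsub>G\<^esub> inv\<^bsub>G\<^esub> \<sigma>) x = x)"

text \<open>Meant for a faithful action on a finite non-empty set \<open>\<Omega>\<close>; then \<open>carrier G\<close> is finite
  and both \<open>card\<close> and \<open>Max\<close> have their usual meaning.\<close>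

definition EKR_property ::
    "('g, 'm) monoid_scheme \<Rightarrow> 'a set \<Rightarrow> ('g \<Rightarrow> 'a \<Rightarrow> 'a) \<Rightarrow> bool"
  where "EKR_property G \<Omega> \<phi> \<longleftrightarrow>
    (\<forall>F. intersecting G \<Omega> \<phi> F \<longrightarrow>
         card F \<le> Max ((\<lambda>x. card (stabilizer G \<phi> x)) ` \<Omega>))"

text \<open>A permutation of \<open>S\<close> is a function on the whole type that fixes every point outside \<open>S\<close>,
  so that permutations of different sets can be composed.\<close>

definition Sym :: "'a set \<Rightarrow> ('a \<Rightarrow> 'a) monoid"
  where "Sym S = \<lparr>carrier = {p. p permutes S}, monoid.mult = (\<circ>), one = id\<rparr>"

definition perm_group :: "'a set \<Rightarrow> ('a \<Rightarrow> 'a) set \<Rightarrow> ('a \<Rightarrow> 'a) monoid"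
  where "perm_group S H = (Sym S)\<lparr>carrier := H\<rparr>"

text \<open>The restriction makes the values extensional, as \<^const>\<open>BijGroup\<close> requires.\<close>

definition natural_action :: "'a set \<Rightarrow> ('a \<Rightarrow> 'a) \<Rightarrow> 'a \<Rightarrow> 'a"
  where "natural_action S g = restrict g S"

definition perm_prod :: "nat \<Rightarrow> (nat \<Rightarrow> 'a \<Rightarrow> 'a) \<Rightarrow> 'a \<Rightarrow> 'a"
  where "perm_prod k g = foldr (\<circ>) (map g [1..<Suc k]) id"

definition internal_product :: "nat \<Rightarrow> (nat \<Rightarrow> ('a \<Rightarrow> 'a) set) \<Rightarrow> ('a \<Rightarrow> 'a) set"
  where "internal_product k G = {perm_prod k g | g. \<forall>i\<in>{1..k}. g i \<in> G i}"

lemma group_Sym: "group (Sym S)"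
  unfolding Sym_def
  by (rule groupI)
    (auto simp: permutes_compose permutes_id comp_assoc intro: permutes_inv permutes_inv_o(2))

lemma faithful_action_perm_group:
  assumes "subgroup H (Sym S)"
  shows "faithful_action (perm_group S H) S (natural_action S)"
proof -
  have perm: "h permutes S" if "h \<in> H" for h
    using subgroup.subset[OF assms] that by (auto simp: Sym_def)
  have grp: "group (perm_group S H)"
    unfolding perm_group_def by (rule group.subgroup_imp_group[OF group_Sym assms])
  have bij: "natural_action S h \<in> Bij S" if "h \<in> H" for h
    using permutes_imp_bij[OF perm[OF that]]
    by (simp add: Bij_def natural_action_def)
  have "natural_action S \<in> hom (perm_group S H) (BijGroup S)"
  proof (rule homI)
    fix g assume "g \<in> carrier (perm_group S H)"
    then show "natural_action S g \<in> carrier (BijGroup S)"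
      using bij by (simp add: perm_group_def BijGroup_def)
  next
    fix g h assume "g \<in> carrier (perm_group S H)" "h \<in> carrier (perm_group S H)"
    then have gh: "g \<in> H" "h \<in> H" by (simp_all add: perm_group_def)
    show "natural_action S (g \<otimes>\<^bsub>perm_group S H\<^esub> h) =
        natural_action S g \<otimes>\<^bsub>BijGroup S\<^esub> natural_action S h"
      using bij[OF gh(1)] bij[OF gh(2)] permutes_in_image[OF perm[OF gh(2)]]
      by (auto simp: BijGroup_def perm_group_def Sym_def natural_action_def compose_def
          fun_eq_iff)
  qed
  moreover have "inj_on (natural_action S) (carrier (perm_group S H))"
  proof (rule inj_onI)
    fix g h
    assume "g \<in> carrier (perm_group S H)" "h \<in> carrier (perm_group S H)"
      and eq: "natural_action S g = natural_action S h"
    then have "g permutes S" "h permutes S" using perm by (simp_all add: perm_group_def)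
    moreover have "g x = h x" if "x \<in> S" for x
      using fun_cong[OF eq, of x] that by (simp add: natural_action_def)
    ultimately show "g = h" unfolding fun_eq_iff by (metis permutes_not_in)
  qed
  ultimately show ?thesis
    by (intro faithful_action.intro group_action.intro group_hom.intro group_hom_axioms.intro
        faithful_action_axioms.intro grp group_BijGroup)
qed

lemma foldr_comp_Cons:
  "foldr (\<circ>) (map g (j # js)) id = g j \<circ> foldr (\<circ>) (map g js) id"
  by simp

lemma foldr_comp_permutes:
  assumes "\<forall>i\<in>set is. g i permutes \<Omega> i"
  shows "foldr (\<circ>) (map g is) id permutes (\<Union>i\<in>set is. \<Omega> i)"
  using assms
proof (induction "is")
  case Nil
  then show ?case by (simp add: permutes_id[unfolded id_def] id_def)
next
  case (Cons j js)
  have "g j permutes (\<Union>i\<in>set (j # js). \<Omega> i)"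
    using Cons.prems by (auto intro: permutes_subset)
  moreover have "foldr (\<circ>) (map g js) id permutes (\<Union>i\<in>set (j # js). \<Omega> i)"
    by (rule permutes_subset[OF Cons.IH]) (use Cons.prems in auto)
  ultimately show ?case
    unfolding foldr_comp_Cons by (rule permutes_compose[rotated])
qed

lemma foldr_comp_apply:
  assumes "distinct is" "disjoint_family_on \<Omega> (set is)"
    and "\<forall>i\<in>set is. g i permutes \<Omega> i" "i \<in> set is" "x \<in> \<Omega> i"
  shows "foldr (\<circ>) (map g is) id x = g i x"
  using assms
proof (induction "is")
  case Nil
  then show ?case by simp
next
  case (Cons j js)
  have js: "foldr (\<circ>) (map g js) id permutes (\<Union>i\<in>set js. \<Omega> i)"
    using Cons.prems by (intro foldr_comp_permutes) auto
  show ?case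
  proof (cases "i = j")
    case True
    then have "x \<notin> (\<Union>i\<in>set js. \<Omega> i)"
      using Cons.prems by (fastforce simp: disjoint_family_on_def)
    with js have "foldr (\<circ>) (map g js) id x = x" by (rule permutes_not_in)
    then show ?thesis using True by (simp only: foldr_comp_Cons comp_apply[of "g j"])
  next
    case False
    then have i: "i \<in> set js" using Cons.prems by simp
    have "disjoint_family_on \<Omega> (set js)"
      using Cons.prems(2) by (rule disjoint_family_on_mono[rotated]) auto
    then have "foldr (\<circ>) (map g js) id x = g i x"
      by (intro Cons.IH) (use Cons.prems i in auto)
    moreover have "g i x \<in> \<Omega> i"
      using Cons.prems permutes_in_image by fastforce
    then have "g i x \<notin> \<Omega> j"
      using Cons.prems False by (auto simp: disjoint_family_on_def)
    then have "g j (g i x) = g i x"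
      using Cons.prems by (auto intro: permutes_not_in)
    ultimately show ?thesis by (simp only: foldr_comp_Cons comp_apply[of "g j"])
  qed
qed

lemma perm_prod_permutes:
  assumes "\<forall>i\<in>{1..k}. g i permutes \<Omega> i"
  shows "perm_prod k g permutes (\<Union>i\<in>{1..k}. \<Omega> i)"
  using foldr_comp_permutes[of "[1..<Suc k]" g \<Omega>] assms
  by (simp add: perm_prod_def atLeastLessThanSuc_atLeastAtMost del: upt_Suc)

lemma natural_action_perm_prod:
  assumes "disjoint_family_on \<Omega> {1..k}" "\<forall>i\<in>{1..k}. g i permutes \<Omega> i"
    and "i \<in> {1..k}" "x \<in> \<Omega> i"
  shows "natural_action (\<Union>i\<in>{1..k}. \<Omega> i) (perm_prod k g) x = g i x"
proof -
  have "perm_prod k g x = g i x"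
    unfolding perm_prod_def
    using assms by (intro foldr_comp_apply[where \<Omega> = \<Omega>])
      (simp_all add: atLeastLessThanSuc_atLeastAtMost del: upt_Suc)
  then show ?thesis using assms(3,4) by (auto simp: natural_action_def)
qed

lemma perm_prod_comp:
  assumes "disjoint_family_on \<Omega> {1..k}"
    and g: "\<forall>i\<in>{1..k}. g i permutes \<Omega> i" and h: "\<forall>i\<in>{1..k}. h i permutes \<Omega> i"
  shows "perm_prod k g \<circ> perm_prod k h = perm_prod k (\<lambda>i. g i \<circ> h i)"
proof
  fix x
  let ?U = "\<Union>i\<in>{1..k}. \<Omega> i"
  have gh: "\<forall>i\<in>{1..k}. (g i \<circ> h i) permutes \<Omega> i"
    using g h by (blast intro: permutes_compose)
  have app: "perm_prod k f y = f i y"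
    if "\<forall>i\<in>{1..k}. f i permutes \<Omega> i" "i \<in> {1..k}" "y \<in> \<Omega> i" for f i y
    using natural_action_perm_prod[OF assms(1) that] that(2,3)
    by (auto simp: natural_action_def split: if_splits)
  show "(perm_prod k g \<circ> perm_prod k h) x = perm_prod k (\<lambda>i. g i \<circ> h i) x"
  proof (cases "x \<in> ?U")
    case True
    then obtain i where i: "i \<in> {1..k}" "x \<in> \<Omega> i" by blast
    have "h i x \<in> \<Omega> i" using h i permutes_in_image by fastforce
    then show ?thesis using app[OF g i(1)] app[OF h i] app[OF gh i] by simp
  next
    case False
    then show ?thesis
      using perm_prod_permutes[OF g] perm_prod_permutes[OF h] perm_prod_permutes[OF gh]
      by (simp add: permutes_not_in)
  qed
qed

lemma perm_prod_id: "(\<And>i. i \<in> {1..k} \<Longrightarrow> g i = id) \<Longrightarrow> perm_prod k g = id"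
proof -
  assume "\<And>i. i \<in> {1..k} \<Longrightarrow> g i = id"
  then have "\<forall>i\<in>{1..k}. g i permutes {}" by (simp add: permutes_empty)
  from perm_prod_permutes[OF this] show ?thesis by simp
qed

lemma subgroup_internal_product:
  assumes "disjoint_family_on \<Omega> {1..k}" and G: "\<forall>i\<in>{1..k}. subgroup (G i) (Sym (\<Omega> i))"
  shows "subgroup (internal_product k G) (Sym (\<Union>i\<in>{1..k}. \<Omega> i))" (is "subgroup ?P ?S")
proof -
  interpret S: group ?S by (rule group_Sym)
  have perm: "g permutes \<Omega> i" if "i \<in> {1..k}" "g \<in> G i" for i g
    using subgroup.subset[of "G i" "Sym (\<Omega> i)"] G that by (auto simp: Sym_def)
  have id: "id \<in> G i" if "i \<in> {1..k}" for i
    using subgroup.one_closed[of "G i" "Sym (\<Omega> i)"] G that by (simp add: Sym_def)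
  have mult: "g \<circ> h \<in> G i" if "i \<in> {1..k}" "g \<in> G i" "h \<in> G i" for i g h
    using subgroup.m_closed[of "G i" "Sym (\<Omega> i)" g h] G that by (simp add: Sym_def)
  have inv: "\<exists>h\<in>G i. h \<circ> g = id" if "i \<in> {1..k}" "g \<in> G i" for i g
  proof -
    have sub: "subgroup (G i) (Sym (\<Omega> i))" using G that by simp
    have "inv\<^bsub>Sym (\<Omega> i)\<^esub> g \<in> G i"
      using subgroup.m_inv_closed[OF sub] that by simp
    moreover have "inv\<^bsub>Sym (\<Omega> i)\<^esub> g \<circ> g = id"
      using group.l_inv[OF group_Sym, of g "\<Omega> i"] perm[OF that] by (simp add: Sym_def)
    ultimately show ?thesis by blast
  qed
  have carrier: "perm_prod k g \<in> carrier ?S" if "\<forall>i\<in>{1..k}. g i \<in> G i" for g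
  proof -
    have "\<forall>i\<in>{1..k}. g i permutes \<Omega> i" using that perm by blast
    from perm_prod_permutes[OF this] show ?thesis by (simp add: Sym_def)
  qed
  show ?thesis
  proof (rule S.subgroupI)
    show "?P \<subseteq> carrier ?S"
      unfolding internal_product_def using carrier by blast
    show "?P \<noteq> {}"
      using id by (auto simp: internal_product_def intro!: exI[of _ "\<lambda>_. id"])
  next
    fix a assume "a \<in> ?P"
    then obtain g where a: "a = perm_prod k g" and g: "\<forall>i\<in>{1..k}. g i \<in> G i"
      by (auto simp: internal_product_def)
    obtain h where h: "\<forall>i\<in>{1..k}. h i \<in> G i \<and> h i \<circ> g i = id"
    proof -
      have "\<forall>i\<in>{1..k}. \<exists>h. h \<in> G i \<and> h \<circ> g i = id" using inv g by blast
      from bchoice[OF this] show ?thesis using that by blast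
    qed
    have "perm_prod k h \<circ> a = perm_prod k (\<lambda>i. h i \<circ> g i)"
      unfolding a using perm g h by (intro perm_prod_comp[OF assms(1)]) auto
    also have "\<dots> = id" using h by (intro perm_prod_id) auto
    finally have "perm_prod k h \<otimes>\<^bsub>?S\<^esub> a = \<one>\<^bsub>?S\<^esub>" by (simp add: Sym_def)
    moreover have "a \<in> carrier ?S" "perm_prod k h \<in> carrier ?S"
      unfolding a using carrier g h by blast+
    ultimately have "inv\<^bsub>?S\<^esub> a = perm_prod k h" by (metis S.inv_equality)
    then show "inv\<^bsub>?S\<^esub> a \<in> ?P" using h by (auto simp: internal_product_def)
  next
    fix a b assume "a \<in> ?P" "b \<in> ?P"
    then obtain g h where ab: "a = perm_prod k g" "b = perm_prod k h"
      and gh: "\<forall>i\<in>{1..k}. g i \<in> G i" "\<forall>i\<in>{1..k}. h i \<in> G i"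
      by (auto simp: internal_product_def)
    have "a \<circ> b = perm_prod k (\<lambda>i. g i \<circ> h i)"
      unfolding ab using perm gh by (intro perm_prod_comp[OF assms(1)]) auto
    then show "a \<otimes>\<^bsub>?S\<^esub> b \<in> ?P"
      using gh mult by (auto simp: Sym_def internal_product_def)
  qed
qed

end

theory Submission
  imports Defs
begin

text \<open>The elements \<open>\<pi>, \<sigma>\<close> of a permutation group fail to intersect iff they are adjacent in its
  derangement graph, and the derangement graph of \<open>H \<cdot> K\<close> is the tensor product of those of \<open>H\<close> and
  \<open>K\<close>; so it suffices to bound independent sets of the tensor product of two graphs, as in Zhang's
  theorem for vertex-transitive graphs. Let \<open>N[A]\<close> be the closed neighbourhood of \<open>A\<close>. Translating
  a maximum independent set, an averaging argument gives \<open>|A| / |N[A]| \<le> \<alpha>(X) / |X|\<close> for every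
  independent set \<open>A\<close> of a derangement graph \<open>X\<close>. An independent set \<open>I\<close> of \<open>X \<times> Y\<close> splits into
  the pairs \<open>(x, y)\<close> such that \<open>x\<close> is isolated in the fibre of \<open>I\<close> over \<open>y\<close>, and the remaining pairs.
  The first part is fibrewise independent in \<open>X\<close>, the second in \<open>Y\<close>, and the fibrewise closed
  neighbourhoods of the two parts are disjoint, so \<open>|I| / |X \<times> Y|\<close> is at most the larger of the two
  independence ratios.\<close>

section \<open>Independent sets in tensor products of graphs\<close>

definition closed_nbhd :: "'a set \<Rightarrow> ('a \<Rightarrow> 'a \<Rightarrow> bool) \<Rightarrow> 'a set \<Rightarrow> 'a set"
  where "closed_nbhd V E A = {x \<in> V. x \<in> A \<or> (\<exists>y\<in>A. E x y)}"

definition indep_set :: "('a \<Rightarrow> 'a \<Rightarrow> bool) \<Rightarrow> 'a set \<Rightarrow> bool"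
  where "indep_set E A \<longleftrightarrow> (\<forall>x\<in>A. \<forall>y\<in>A. \<not> E x y)"

text \<open>The hypotheses are the ratio bounds cleared of denominators; \<open>a\<close> and
  \<open>b\<close> will be orders of point stabilizers. After scaling by
  \<open>card V * card W\<close>, they charge the two parts of \<open>I\<close> to disjoint subsets
  of \<open>V \<times> W\<close>, at rates \<open>a * card W\<close> and
  \<open>b * card V\<close>.\<close>

lemma card_indep_tensor_product_le:
  fixes E :: "'a \<Rightarrow> 'a \<Rightarrow> bool" and F :: "'b \<Rightarrow> 'b \<Rightarrow> bool"
  assumes fin: "finite V" "finite W"
    and sym: "symp E" "symp F"
    and V: "\<And>A. A \<subseteq> V \<Longrightarrow> indep_set E A \<Longrightarrow> card A * card V \<le> a * card (closed_nbhd V E A)"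
    and W: "\<And>B. B \<subseteq> W \<Longrightarrow> indep_set F B \<Longrightarrow> card B * card W \<le> b * card (closed_nbhd W F B)"
    and I: "I \<subseteq> V \<times> W"
    and indep: "indep_set (\<lambda>p q. E (fst p) (fst q) \<and> F (snd p) (snd q)) I"
  shows "card I \<le> max (a * card W) (b * card V)"
proof (cases "I = {}")
  case False
  then have "V \<noteq> {}" "W \<noteq> {}" using I by auto
  then have pos: "card V * card W > 0" using fin by (simp add: card_gt_0_iff)
  have no_edge: "\<not> (E x x' \<and> F y y')" if "(x, y) \<in> I" "(x', y') \<in> I" for x y x' y'
    using indep that unfolding indep_set_def by fastforce
  have Es: "E x y \<Longrightarrow> E y x" for x y using sym(1) by (rule sympD)
  have Fs: "F x y \<Longrightarrow> F y x" for x y using sym(2) by (rule sympD)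
  \<comment> \<open>\<open>A y\<close> consists of the isolated vertices of the fibre of
    \<open>I\<close> over \<open>y\<close>; \<open>C x\<close> collects the \<open>y\<close> for
    which \<open>(x, y)\<close> lies in the remaining part.\<close>
  define A where "A y = {x. (x, y) \<in> I \<and> \<not> (\<exists>x'. (x', y) \<in> I \<and> E x x')}" for y
  define C where "C x = {y. (x, y) \<in> I \<and> (\<exists>x'. (x', y) \<in> I \<and> E x x')}" for x
  let ?m = "max (a * card W) (b * card V)"
  let ?P = "SIGMA y:W. A y" and ?Q = "SIGMA x:V. C x"
  let ?NP = "SIGMA y:W. closed_nbhd V E (A y)" and ?NQ = "SIGMA x:V. closed_nbhd W F (C x)"
  have A_sub: "A y \<subseteq> V" for y using I by (auto simp: A_def)
  have C_sub: "C x \<subseteq> W" for x using I by (auto simp: C_def)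
  have finA: "finite (A y)" for y using A_sub fin(1) by (rule finite_subset)
  have finC: "finite (C x)" for x using C_sub fin(2) by (rule finite_subset)
  have finN: "finite (closed_nbhd V E X)" "finite (closed_nbhd W F Y)" for X Y
    using fin by (auto simp: closed_nbhd_def)
  have A_indep: "indep_set E (A y)" for y
    by (auto simp: A_def indep_set_def)
  \<comment> \<open>If \<open>y\<close> and \<open>y'\<close> in \<open>C x\<close> were adjacent, a
    neighbour \<open>x'\<close> of \<open>x\<close> in the fibre over \<open>y'\<close> would make
    \<open>(x, y)\<close> and \<open>(x', y')\<close> adjacent points of \<open>I\<close>.\<close>
  have C_indep: "indep_set F (C x)" for x
    unfolding indep_set_def C_def using no_edge by blast
  have "I = prod.swap ` ?P \<union> ?Q"
    using I by (auto simp: A_def C_def image_iff)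
  then have "card I \<le> card (prod.swap ` ?P) + card ?Q"
    by (metis card_Un_le)
  also have "\<dots> = (\<Sum>y\<in>W. card (A y)) + (\<Sum>x\<in>V. card (C x))"
    using fin finA finC by (simp add: card_image)
  finally have "card I * (card V * card W) \<le>
      ((\<Sum>y\<in>W. card (A y)) + (\<Sum>x\<in>V. card (C x))) * (card V * card W)"
    by (rule mult_right_mono) simp
  also have "\<dots> = (\<Sum>y\<in>W. card (A y) * card V) * card W + (\<Sum>x\<in>V. card (C x) * card W) * card V"
    unfolding sum_distrib_right[symmetric] by (simp add: algebra_simps)
  also have "\<dots> \<le> (\<Sum>y\<in>W. a * card (closed_nbhd V E (A y))) * card W +
      (\<Sum>x\<in>V. b * card (closed_nbhd W F (C x))) * card V"
    using V[OF A_sub A_indep] W[OF C_sub C_indep]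
    by (intro add_mono mult_right_mono sum_mono) auto
  also have "\<dots> = (a * card W) * card ?NP + (b * card V) * card ?NQ"
    using fin finN by (simp add: sum_distrib_left[symmetric] algebra_simps)
  also have "\<dots> \<le> ?m * card ?NP + ?m * card ?NQ"
    by (intro add_mono mult_right_mono) auto
  also have "\<dots> = ?m * (card (prod.swap ` ?NP) + card ?NQ)"
    by (simp add: card_image distrib_left)
  also have "card (prod.swap ` ?NP) + card ?NQ = card (prod.swap ` ?NP \<union> ?NQ)"
  proof (rule card_Un_disjoint[symmetric])
    \<comment> \<open>If \<open>y\<close> is in \<open>C x\<close>, then \<open>x\<close> is a
      non-isolated vertex of the fibre over \<open>y\<close>, so it is neither in \<open>A y\<close>
      nor adjacent to a member of it. If \<open>y\<close> is adjacent to some \<open>y'\<close> in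
      \<open>C x\<close>, there is an edge inside \<open>I\<close>: from \<open>(x, y)\<close> to
      \<open>(x', y')\<close> with \<open>x'\<close> a neighbour of \<open>x\<close> over
      \<open>y'\<close> when \<open>x\<close> is in \<open>A y\<close>, and from
      \<open>(x0, y)\<close> to \<open>(x, y')\<close> when \<open>x\<close> is adjacent to
      \<open>x0\<close> in \<open>A y\<close>.\<close>
    have "\<not> (x \<in> closed_nbhd V E (A y) \<and> y \<in> closed_nbhd W F (C x))" for x y
      unfolding closed_nbhd_def A_def C_def using no_edge Es Fs by blast
    then show "prod.swap ` ?NP \<inter> ?NQ = {}" by auto
  qed (use fin finN in auto)
  also have "\<dots> \<le> card (V \<times> W)"
    using fin by (intro card_mono) (auto simp: closed_nbhd_def)
  finally have "card I * (card V * card W) \<le> ?m * (card V * card W)"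
    by (simp add: card_cartesian_product)
  then show ?thesis using pos by simp
qed simp

section \<open>Permutation groups and their derangement graphs\<close>

abbreviation fixer :: "('a \<Rightarrow> 'a) set \<Rightarrow> 'a \<Rightarrow> ('a \<Rightarrow> 'a) set"
  where "fixer H x \<equiv> {h \<in> H. h x = x}"

abbreviation deranged :: "'a set \<Rightarrow> ('a \<Rightarrow> 'a) \<Rightarrow> ('a \<Rightarrow> 'a) \<Rightarrow> bool"
  where "deranged S p q \<equiv> \<forall>x\<in>S. p x \<noteq> q x"

lemma subgroup_Sym_permutes:
  assumes "subgroup H (Sym S)" "h \<in> H"
  shows "h permutes S"
  using subgroup.subset[OF assms(1)] assms(2) by (auto simp: Sym_def)

lemma subgroup_Sym_comp:
  assumes "subgroup H (Sym S)" "g \<in> H" "h \<in> H"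
  shows "g \<circ> h \<in> H"
  using subgroup.m_closed[OF assms] by (simp add: Sym_def)

lemma inv_Sym:
  assumes "h permutes S"
  shows "inv\<^bsub>Sym S\<^esub> h = inv_into UNIV h"
  using assms
  by (intro group.inv_equality[OF group_Sym])
    (auto simp: Sym_def permutes_inv permutes_inv_o)

lemma subgroup_Sym_inv:
  assumes "subgroup H (Sym S)" "h \<in> H"
  shows "inv_into UNIV h \<in> H"
  using subgroup.m_inv_closed[OF assms] inv_Sym[OF subgroup_Sym_permutes[OF assms]] by simp

lemma finite_subgroup_Sym:
  assumes "finite S" "subgroup H (Sym S)"
  shows "finite H"
  by (rule finite_subset[OF _ finite_permutations[OF assms(1)]])
    (use subgroup_Sym_permutes[OF assms(2)] in auto)

text \<open>Substituting \<open>x = q y\<close> turns a fixed point \<open>x\<close> of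
  \<open>p\<close> composed with the inverse of \<open>q\<close> into a point \<open>y\<close> at
  which \<open>p\<close> and \<open>q\<close> agree.\<close>

lemma intersecting_perm_group_iff:
  assumes "subgroup H (Sym S)"
  shows "intersecting (perm_group S H) S (natural_action S) F \<longleftrightarrow>
    F \<subseteq> H \<and> indep_set (deranged S) F"
proof -
  have "(\<exists>x\<in>S. natural_action S (p \<otimes>\<^bsub>perm_group S H\<^esub> inv\<^bsub>perm_group S H\<^esub> q) x = x) \<longleftrightarrow>
      (\<exists>x\<in>S. p x = q x)" if "p \<in> H" "q \<in> H" for p q
  proof -
    have q: "q permutes S" using subgroup_Sym_permutes[OF assms that(2)] .
    have "inv\<^bsub>perm_group S H\<^esub> q = inv_into UNIV q"
      unfolding perm_group_def
      using group.m_inv_consistent[OF group_Sym assms that(2)] inv_Sym[OF q] by simp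
    then have "(\<exists>x\<in>S. natural_action S (p \<otimes>\<^bsub>perm_group S H\<^esub> inv\<^bsub>perm_group S H\<^esub> q) x = x) \<longleftrightarrow>
        (\<exists>x\<in>S. p (inv_into UNIV q x) = x)"
      by (auto simp: natural_action_def perm_group_def Sym_def)
    also have "\<dots> \<longleftrightarrow> (\<exists>x\<in>S. p x = q x)"
      using q permutes_in_image[OF q] permutes_in_image[OF permutes_inv[OF q]]
      by (metis permutes_inverses)
    finally show ?thesis .
  qed
  then show ?thesis
    unfolding intersecting_def indep_set_def by (auto simp: perm_group_def subset_iff)
qed

lemma EKR_property_perm_group_iff:
  assumes "subgroup H (Sym S)"
  shows "EKR_property (perm_group S H) S (natural_action S) \<longleftrightarrow>
    (\<forall>F\<subseteq>H. indep_set (deranged S) F \<longrightarrow> card F \<le> Max ((\<lambda>x. card (fixer H x)) ` S))"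
proof -
  have "(\<lambda>x. card (stabilizer (perm_group S H) (natural_action S) x)) ` S =
      (\<lambda>x. card (fixer H x)) ` S"
    by (intro image_cong refl arg_cong[where f = card])
      (auto simp: stabilizer_def perm_group_def natural_action_def)
  then show ?thesis
    unfolding EKR_property_def intersecting_perm_group_iff[OF assms] by auto
qed

text \<open>Elements outside the closed neighbourhood intersect every member of \<open>A\<close>, so
  those of them lying in one translate of the stabilizer can be added to \<open>A\<close> without
  losing independence. Averaging over all translates gives the bound.\<close>

lemma EKR_closed_nbhd_bound:
  assumes fin: "finite S" and x: "x \<in> S" and H: "subgroup H (Sym S)"
    and max: "\<And>F. F \<subseteq> H \<Longrightarrow> indep_set (deranged S) F \<Longrightarrow> card F \<le> card (fixer H x)"
    and A: "A \<subseteq> H" "indep_set (deranged S) A"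
  shows "card A * card H \<le> card (fixer H x) * card (closed_nbhd H (deranged S) A)"
proof -
  let ?a = "card (fixer H x)" and ?N = "closed_nbhd H (deranged S) A"
  have finH: "finite H" using fin H by (rule finite_subgroup_Sym)
  define B where "B = H - ?N"
  \<comment> \<open>The sets \<open>T g\<close> are the translates of the stabilizer of \<open>x\<close>.\<close>
  define T where "T g = {p \<in> H. p (g x) = x}" for g :: "'a \<Rightarrow> 'a"
  have B_sub: "B \<subseteq> H" by (auto simp: B_def)
  have finB: "finite B" and finA: "finite A" using finH B_sub A(1) finite_subset by blast+
  \<comment> \<open>Left multiplication by \<open>p\<close> carries these \<open>g\<close> onto the
    stabilizer, so \<open>p\<close> lies in \<open>T g\<close> for exactly \<open>?a\<close> indices
    \<open>g\<close>.\<close>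
  have count: "card {g \<in> H. p (g x) = x} = ?a" if p: "p \<in> H" for p
  proof (rule bij_betw_same_card)
    have pp: "p permutes S" using subgroup_Sym_permutes[OF H p] .
    show "bij_betw (\<lambda>g. p \<circ> g) {g \<in> H. p (g x) = x} (fixer H x)"
      by (rule bij_betw_byWitness[where f' = "\<lambda>g. inv_into UNIV p \<circ> g"])
        (use subgroup_Sym_comp[OF H p] subgroup_Sym_comp[OF H subgroup_Sym_inv[OF H p]]
          permutes_inverses[OF pp] in \<open>auto simp: fun_eq_iff\<close>)
  qed
  have bound: "card A + card (T g \<inter> B) \<le> ?a" if g: "g \<in> H" for g
  proof -
    have gx: "g x \<in> S" using subgroup_Sym_permutes[OF H g] x by (simp add: permutes_in_image)
    have "indep_set (deranged S) (A \<union> (T g \<inter> B))"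
      unfolding indep_set_def
    proof (intro ballI)
      fix p q assume pq: "p \<in> A \<union> (T g \<inter> B)" "q \<in> A \<union> (T g \<inter> B)"
      have AB: "\<exists>y\<in>S. q y = p y" if "p \<in> A" "q \<in> B" for p q
        using that unfolding B_def closed_nbhd_def by blast
      \<comment> \<open>Two members of \<open>A\<close> intersect by assumption, a member of
        \<open>A\<close> and one of \<open>B\<close> by \<open>AB\<close>, and two members of
        \<open>T g\<close> agree at \<open>g x\<close>.\<close>
      show "\<not> deranged S p q"
        using pq A(2) AB[of p q] AB[of q p] gx unfolding indep_set_def T_def by fastforce
    qed
    then have "card (A \<union> (T g \<inter> B)) \<le> ?a"
      using A B_sub by (intro max) auto
    moreover have "A \<inter> (T g \<inter> B) = {}"
      using A(1) by (auto simp: B_def closed_nbhd_def)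
    ultimately show ?thesis using finA finB by (simp add: card_Un_disjoint)
  qed
  \<comment> \<open>Double counting of the pairs \<open>(g, p)\<close> with \<open>p\<close> in
    \<open>T g \<inter> B\<close>.\<close>
  have "(\<Sum>g\<in>H. card (T g \<inter> B)) = (\<Sum>g\<in>H. \<Sum>p\<in>B. if p (g x) = x then 1 else 0)"
    using finB B_sub
    by (intro sum.cong refl) (auto simp: T_def sum.If_cases intro!: arg_cong[where f = card])
  also have "\<dots> = (\<Sum>p\<in>B. \<Sum>g\<in>H. if p (g x) = x then 1 else 0)"
    by (rule sum.swap)
  also have "\<dots> = (\<Sum>p\<in>B. card {g \<in> H. p (g x) = x})"
    using finH by (simp add: sum.If_cases Int_def)
  also have "\<dots> = card B * ?a"
    using count B_sub by (simp add: subset_iff)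
  finally have "card A * card H + card B * ?a = (\<Sum>g\<in>H. card A + card (T g \<inter> B))"
    by (simp add: sum.distrib mult.commute)
  also have "\<dots> \<le> card H * ?a"
    using sum_bounded_above[of H "\<lambda>g. card A + card (T g \<inter> B)" ?a] bound by simp
  also have "card H * ?a = ?a * card ?N + card B * ?a"
  proof -
    have "card H = card ?N + card B"
      unfolding B_def using finH
      by (metis (no_types, lifting) add_diff_inverse_nat card_Diff_subset card_mono
          closed_nbhd_def finite_subset mem_Collect_eq not_less subsetI)
    then show ?thesis by (simp only: algebra_simps)
  qed
  finally show ?thesis by simp
qed

section \<open>Products of two groups with disjoint supports\<close>

lemma EKR_obtain_fixer:
  assumes "finite S" "S \<noteq> {}" "subgroup H (Sym S)"
    and "EKR_property (perm_group S H) S (natural_action S)"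
  obtains x where "x \<in> S"
    "\<And>F. F \<subseteq> H \<Longrightarrow> indep_set (deranged S) F \<Longrightarrow> card F \<le> card (fixer H x)"
proof -
  have "Max ((\<lambda>x. card (fixer H x)) ` S) \<in> (\<lambda>x. card (fixer H x)) ` S"
    using assms(1,2) by (intro Max_in) auto
  then show ?thesis
    using that assms(4) unfolding EKR_property_perm_group_iff[OF assms(3)] by fastforce
qed

text \<open>Disjointness makes the factorization \<open>h \<circ> k\<close> unique, and two products
  are deranged exactly when both components are, which is adjacency in the tensor product. A
  stabilizer in the product constrains only one factor, so its order is one of the two kinds of
  terms in the graph bound.\<close>

lemma EKR_property_comp:
  fixes H K :: "('a \<Rightarrow> 'a) set"
  assumes S: "finite S" "S \<noteq> {}" and T: "finite T" "T \<noteq> {}" and disj: "S \<inter> T = {}"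
    and H: "subgroup H (Sym S)" and K: "subgroup K (Sym T)"
    and HK: "subgroup {h \<circ> k | h k. h \<in> H \<and> k \<in> K} (Sym (S \<union> T))" (is "subgroup ?HK _")
    and ekrH: "EKR_property (perm_group S H) S (natural_action S)"
    and ekrK: "EKR_property (perm_group T K) T (natural_action T)"
  shows "EKR_property (perm_group (S \<union> T) ?HK) (S \<union> T) (natural_action (S \<union> T))"
proof -
  let ?c = "\<lambda>(h, k). h \<circ> k :: 'a \<Rightarrow> 'a"
  let ?M = "Max ((\<lambda>x. card (fixer ?HK x)) ` (S \<union> T))"
  have onS: "(h \<circ> k) x = h x" if "k \<in> K" "x \<in> S" for h k x
    using permutes_not_in[OF subgroup_Sym_permutes[OF K that(1)], of x] that disj
    by (simp add: disjoint_iff)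
  have onT: "(h \<circ> k) x = k x" if "h \<in> H" "k \<in> K" "x \<in> T" for h k x
    using permutes_not_in[OF subgroup_Sym_permutes[OF H that(1)], of "k x"] that disj
      permutes_in_image[OF subgroup_Sym_permutes[OF K that(2)], of x]
    by (auto simp: disjoint_iff)
  have inj: "inj_on ?c (H \<times> K)"
  proof (rule inj_onI, clarify)
    fix h k h' k' assume hk: "h \<in> H" "k \<in> K" "h' \<in> H" "k' \<in> K" and eq: "h \<circ> k = h' \<circ> k'"
    have "h x = h' x" for x
      using fun_cong[OF eq, of x] onS hk permutes_not_in subgroup_Sym_permutes[OF H] by metis
    moreover have "k x = k' x" for x
      using fun_cong[OF eq, of x] onT hk permutes_not_in subgroup_Sym_permutes[OF K] by metis
    ultimately show "h = h' \<and> k = k'" by blast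
  qed
  have finH: "finite H" and finK: "finite K"
    using finite_subgroup_Sym S T H K by blast+
  have le_M: "card (fixer ?HK x) \<le> ?M" if "x \<in> S \<union> T" for x
    using S T that by (intro Max_ge) auto
  have M_S: "card (fixer H x) * card K \<le> ?M" if "x \<in> S" for x
  proof -
    have im: "?c ` (fixer H x \<times> K) = fixer ?HK x"
    proof (intro equalityI subsetI)
      fix f assume "f \<in> ?c ` (fixer H x \<times> K)"
      then obtain h k where hk: "h \<in> H" "k \<in> K" "(h, k) \<in> fixer H x \<times> K" "f = h \<circ> k" by auto
      then have "f x = x" using onS[of k x h] that by auto
      then show "f \<in> fixer ?HK x" using hk by blast
    next
      fix f assume "f \<in> fixer ?HK x"
      then obtain h k where hk: "h \<in> H" "k \<in> K" "f = h \<circ> k" "f x = x" by blast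
      then have "(h, k) \<in> fixer H x \<times> K" using onS[of k x h] that by auto
      then show "f \<in> ?c ` (fixer H x \<times> K)" using hk(3) by (intro image_eqI[of _ _ "(h, k)"]) auto
    qed
    have "inj_on ?c (fixer H x \<times> K)" by (rule inj_on_subset[OF inj]) auto
    then have "card (fixer ?HK x) = card (fixer H x \<times> K)"
      unfolding im[symmetric] by (rule card_image)
    then show ?thesis
      using le_M[of x] that by (simp add: card_cartesian_product)
  qed
  have M_T: "card (fixer K x) * card H \<le> ?M" if "x \<in> T" for x
  proof -
    have im: "?c ` (H \<times> fixer K x) = fixer ?HK x"
    proof (intro equalityI subsetI)
      fix f assume "f \<in> ?c ` (H \<times> fixer K x)"
      then obtain h k where hk: "h \<in> H" "k \<in> K" "(h, k) \<in> H \<times> fixer K x" "f = h \<circ> k" by auto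
      then have "f x = x" using onT[of h k x] that by auto
      then show "f \<in> fixer ?HK x" using hk by blast
    next
      fix f assume "f \<in> fixer ?HK x"
      then obtain h k where hk: "h \<in> H" "k \<in> K" "f = h \<circ> k" "f x = x" by blast
      then have "(h, k) \<in> H \<times> fixer K x" using onT[of h k x] that by auto
      then show "f \<in> ?c ` (H \<times> fixer K x)" using hk(3) by (intro image_eqI[of _ _ "(h, k)"]) auto
    qed
    have "inj_on ?c (H \<times> fixer K x)" by (rule inj_on_subset[OF inj]) auto
    then have "card (fixer ?HK x) = card (H \<times> fixer K x)"
      unfolding im[symmetric] by (rule card_image)
    then show ?thesis
      using le_M[of x] that by (simp add: card_cartesian_product mult.commute)
  qed
  \<comment> \<open>The stabilizers of \<open>x\<close> and of \<open>y\<close> below bound all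
    independent sets of the two factors; their orders become the \<open>a\<close> and
    \<open>b\<close> of the graph bound.\<close>
  obtain x where x: "x \<in> S"
    "\<And>F. F \<subseteq> H \<Longrightarrow> indep_set (deranged S) F \<Longrightarrow> card F \<le> card (fixer H x)"
    using EKR_obtain_fixer[OF S H ekrH] by blast
  obtain y where y: "y \<in> T"
    "\<And>F. F \<subseteq> K \<Longrightarrow> indep_set (deranged T) F \<Longrightarrow> card F \<le> card (fixer K y)"
    using EKR_obtain_fixer[OF T K ekrK] by blast
  show ?thesis
    unfolding EKR_property_perm_group_iff[OF HK]
  proof (intro allI impI)
    fix F assume F: "F \<subseteq> ?HK" and indep: "indep_set (deranged (S \<union> T)) F"
    \<comment> \<open>Pulling \<open>F\<close> back to pairs gives a vertex set of the tensor
      product.\<close>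
    define I where "I = {p \<in> H \<times> K. ?c p \<in> F}"
    have "F = ?c ` I" using F unfolding I_def by auto
    moreover have "finite I" using finH finK by (simp add: I_def)
    ultimately have "card F \<le> card I" using card_image_le[of I ?c] by simp
    also have "card I \<le> max (card (fixer H x) * card K) (card (fixer K y) * card H)"
    proof (rule card_indep_tensor_product_le[where E = "deranged S" and F = "deranged T"])
      show "indep_set (\<lambda>p q. deranged S (fst p) (fst q) \<and> deranged T (snd p) (snd q)) I"
        unfolding indep_set_def
      proof (intro ballI notI)
        fix p q assume pq: "p \<in> I" "q \<in> I"
          and d: "deranged S (fst p) (fst q) \<and> deranged T (snd p) (snd q)"
        obtain h k h' k' where [simp]: "p = (h, k)" "q = (h', k')" by (cases p, cases q)
        have "h \<in> H" "k \<in> K" "h' \<in> H" "k' \<in> K" using pq by (auto simp: I_def)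
        then have "deranged (S \<union> T) (h \<circ> k) (h' \<circ> k')"
          using d by (auto simp: onS onT simp del: comp_apply)
        moreover have "h \<circ> k \<in> F" "h' \<circ> k' \<in> F" using pq by (auto simp: I_def)
        ultimately show False using indep unfolding indep_set_def by blast
      qed
      show "card A * card H \<le> card (fixer H x) * card (closed_nbhd H (deranged S) A)"
        if "A \<subseteq> H" "indep_set (deranged S) A" for A
        using EKR_closed_nbhd_bound[OF S(1) x(1) H x(2)] that by blast
      show "card A * card K \<le> card (fixer K y) * card (closed_nbhd K (deranged T) A)"
        if "A \<subseteq> K" "indep_set (deranged T) A" for A
        using EKR_closed_nbhd_bound[OF T(1) y(1) K y(2)] that by blast
    qed (use finH finK in \<open>auto simp: I_def symp_def\<close>)
    also have "\<dots> \<le> ?M" using M_S[OF x(1)] M_T[OF y(1)] by simp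
    finally show "card F \<le> ?M" .
  qed
qed

section \<open>Induction on the number of factors\<close>

lemma foldr_comp_conv: "foldr (\<circ>) fs f = foldr (\<circ>) fs id \<circ> f"
  by (induction fs) (simp_all add: comp_assoc)

text \<open>The index list grows at its right end while \<open>foldr\<close> peels from the left;
  associativity lets the last factor be split off.\<close>

lemma perm_prod_Suc: "perm_prod (Suc k) g = perm_prod k g \<circ> g (Suc k)"
  unfolding perm_prod_def using foldr_comp_conv[of "map g [1..<Suc k]" "g (Suc k)"]
  by simp

lemma internal_product_Suc:
  "internal_product (Suc k) G = {p \<circ> q | p q. p \<in> internal_product k G \<and> q \<in> G (Suc k)}"
proof (intro equalityI subsetI)
  fix f assume "f \<in> {p \<circ> q | p q. p \<in> internal_product k G \<and> q \<in> G (Suc k)}"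
  then obtain g q where f: "f = perm_prod k g \<circ> q" and g: "\<forall>i\<in>{1..k}. g i \<in> G i"
    and q: "q \<in> G (Suc k)"
    by (auto simp: internal_product_def)
  \<comment> \<open>The product of the first \<open>k\<close> factors does not see the value of
    \<open>g\<close> at \<open>Suc k\<close>, so \<open>q\<close> can be stored there.\<close>
  let ?g = "g(Suc k := q)"
  have "map g [1..<Suc k] = map ?g [1..<Suc k]" by (rule map_cong) auto
  then have "f = perm_prod (Suc k) ?g"
    unfolding f perm_prod_Suc by (simp add: perm_prod_def del: upt_Suc)
  moreover have "\<forall>i\<in>{1..Suc k}. ?g i \<in> G i" using g q by (auto simp: le_Suc_eq)
  ultimately show "f \<in> internal_product (Suc k) G" unfolding internal_product_def by blast
next
  fix f assume "f \<in> internal_product (Suc k) G"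
  then obtain g where "f = perm_prod k g \<circ> g (Suc k)" "\<forall>i\<in>{1..Suc k}. g i \<in> G i"
    unfolding internal_product_def perm_prod_Suc by blast
  moreover from this(2) have "perm_prod k g \<in> internal_product k G" "g (Suc k) \<in> G (Suc k)"
    unfolding internal_product_def by auto
  ultimately show "f \<in> {p \<circ> q | p q. p \<in> internal_product k G \<and> q \<in> G (Suc k)}"
    by blast
qed

theorem theorem5p16:
  fixes n k :: nat
    and \<Omega> :: "nat \<Rightarrow> nat set"
    and G :: "nat \<Rightarrow> (nat \<Rightarrow> nat) set"
  assumes "k \<ge> 1"
    and "\<forall>i\<in>{1..k}. \<Omega> i \<noteq> {} \<and> \<Omega> i \<subseteq> {1..n}"
    and "disjoint_family_on \<Omega> {1..k}"
    and "\<forall>i\<in>{1..k}. subgroup (G i) (Sym (\<Omega> i))"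
    and "\<forall>i\<in>{1..k}. EKR_property (perm_group (\<Omega> i) (G i)) (\<Omega> i) (natural_action (\<Omega> i))"
  shows "EKR_property (perm_group (\<Union>i\<in>{1..k}. \<Omega> i) (internal_product k G))
           (\<Union>i\<in>{1..k}. \<Omega> i) (natural_action (\<Union>i\<in>{1..k}. \<Omega> i))"
  using assms
\<comment> \<open>The induction starts at 1, since zero factors would leave no points to take the
  maximum over.\<close>
proof (induction k rule: nat_induct_at_least)
  case base
  have "internal_product 1 G = G 1"
    \<comment> \<open>A constant family represents each element of \<open>G 1\<close>.\<close>
    by (auto simp: internal_product_def perm_prod_def intro: exI[of _ "\<lambda>_. _"])
  then show ?case using base by simp
next
  case (Suc k)
  let ?U = "\<Union>i\<in>{1..k}. \<Omega> i"
  have U: "(\<Union>i\<in>{1..Suc k}. \<Omega> i) = ?U \<union> \<Omega> (Suc k)"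
    by (simp add: atLeastAtMostSuc_conv Un_commute)
  have disj: "disjoint_family_on \<Omega> {1..k}"
    using Suc.prems(2) by (rule disjoint_family_on_mono[rotated]) auto
  have sub: "subgroup (internal_product k G) (Sym ?U)"
    using Suc.prems(3) by (intro subgroup_internal_product disj) auto
  show ?case
    unfolding U internal_product_Suc
  proof (rule EKR_property_comp[OF _ _ _ _ _ sub])
    have "?U \<subseteq> {1..n}" "\<Omega> (Suc k) \<subseteq> {1..n}" using Suc.prems(1) by auto
    then show "finite ?U" "finite (\<Omega> (Suc k))" by (auto intro: finite_subset)
    show "?U \<noteq> {}" "\<Omega> (Suc k) \<noteq> {}" using Suc.prems(1) \<open>k \<ge> 1\<close> by fastforce+
    have "\<Omega> i \<inter> \<Omega> (Suc k) = {}" if "i \<in> {1..k}" for i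
      using disjoint_family_onD[OF Suc.prems(2), of i "Suc k"] that by simp
    then show "?U \<inter> \<Omega> (Suc k) = {}" by blast
    show "subgroup {h \<circ> q | h q. h \<in> internal_product k G \<and> q \<in> G (Suc k)} (Sym (?U \<union> \<Omega> (Suc k)))"
      using subgroup_internal_product[OF Suc.prems(2,3)] unfolding U internal_product_Suc .
    show "EKR_property (perm_group ?U (internal_product k G)) ?U (natural_action ?U)"
      using Suc.prems disj by (intro Suc.IH) simp_all
  qed (use Suc.prems in auto)
qed

end
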